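(* Let $c$ be an integer, let $\mu$ be the $(\mathrm{tw},c)$-modulator number, and let $\mathcal G$ be a graph class with clique-bounded $\mu$ (a $(\mu,\omega)$-bounded class). Then $\mathcal G$ has bounded $\alpha$-treewidth.
   Context: All graphs are finite, simple and undirected; $\alpha,\omega$ denote independence and clique number. A graph class is a set of graphs closed under isomorphism. A tree decomposition of $G$ is a pair $(T,\beta)$ with $T$ a tree and bags $\beta(x)\subseteq V(G)$ such that every vertex is in some bag, every edge has both ends in a common bag, and for each vertex the nodes whose bags contain it induce a connected subtree. Here treewidth $\mathrm{tw}(G)$ is the minimum over tree decompositions of the maximum bag size $\max_x|\beta(x)|$ (no $-1$), and $\alpha$-treewidth $\alpha\text{-}\mathrm{tw}(G)$ is the minimum over tree decompositions of $\max_x\alpha(G[\beta(x)])$. The $(\mathrm{tw},c)$-modulator number $\mu(G)$ is the minimum $|S|$ over sets $S\subseteq V(G)$ with $\mathrm{tw}(G-S)\le c$. A class $\mathcal G$ has clique-bounded $\mu$ if there is a nondecreasing $f$ with $\mu(G')\le f(\omega(G'))$ for every induced subgraph $G'$ of every $G\in\mathcal G$; it has bounded $\alpha$-treewidth if there is an integer $k$ with $\alpha\text{-}\mathrm{tw}(G')\le k$ for all such $G'$. *)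

theory Defs
  imports "Graph_Theory.Graph_Theory" "HOL-Library.Extended_Nat"
begin

text \<open>
  Graphs are the finite simple undirected graphs \<open>pair_graph\<close> of the AFP entry Graph\_Theory: an
  edge \<open>uv\<close> is represented by the two arcs \<open>(u,v)\<close> and \<open>(v,u)\<close>.
\<close>

definition pair_induce :: "'a pair_pre_digraph \<Rightarrow> 'a set \<Rightarrow> 'a pair_pre_digraph" where
  "pair_induce G S = \<lparr> pverts = S, parcs = {e \<in> parcs G. fst e \<in> S \<and> snd e \<in> S} \<rparr>"

lemma with_proj_pair_induce: "with_proj (pair_induce G S) = with_proj G \<restriction> S"
  by (simp add: with_proj_def pair_induce_def induce_subgraph_def)

definition independent_in :: "'a pair_pre_digraph \<Rightarrow> 'a set \<Rightarrow> bool" where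
  "independent_in G S \<longleftrightarrow> S \<subseteq> pverts G \<and> (\<forall>u\<in>S. \<forall>v\<in>S. (u, v) \<notin> parcs G)"

definition clique_in :: "'a pair_pre_digraph \<Rightarrow> 'a set \<Rightarrow> bool" where
  "clique_in G S \<longleftrightarrow> S \<subseteq> pverts G \<and> (\<forall>u\<in>S. \<forall>v\<in>S. u \<noteq> v \<longrightarrow> (u, v) \<in> parcs G)"

definition independence_number :: "'a pair_pre_digraph \<Rightarrow> nat" where
  "independence_number G = Max (card ` {S. independent_in G S})"

definition clique_number :: "'a pair_pre_digraph \<Rightarrow> nat" where
  "clique_number G = Max (card ` {S. clique_in G S})"

text \<open>
  Graph\_Theory's \<open>tree\<close> is not usable here: its \<open>forest\<close> forbids all directed cycles, hence also
  the closed walks \<open>u, v, u\<close> along a single undirected edge. The cycles of an undirected graph are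
  the directed ones of length at least 3. Note that \<open>connected\<close> entails nonemptiness.
\<close>

definition undirected_tree :: "'t pair_pre_digraph \<Rightarrow> bool" where
  "undirected_tree T \<longleftrightarrow> pair_graph T \<and> Digraph_Component.connected (with_proj T) \<and>
     \<not> (\<exists>p. pre_digraph.cycle (with_proj T) p \<and> 3 \<le> length p)"

definition tree_decomposition ::
    "'a pair_pre_digraph \<Rightarrow> 't pair_pre_digraph \<Rightarrow> ('t \<Rightarrow> 'a set) \<Rightarrow> bool" where
  "tree_decomposition G T \<beta> \<longleftrightarrow> undirected_tree T \<and>
     (\<forall>x\<in>pverts T. \<beta> x \<subseteq> pverts G) \<and>
     (\<forall>v\<in>pverts G. \<exists>x\<in>pverts T. v \<in> \<beta> x) \<and>
     (\<forall>(u, v)\<in>parcs G. \<exists>x\<in>pverts T. u \<in> \<beta> x \<and> v \<in> \<beta> x) \<and>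
     (\<forall>v\<in>pverts G. Digraph_Component.connected (with_proj T \<restriction> {x \<in> pverts T. v \<in> \<beta> x}))"

text \<open>
  In both width parameters the nodes of the decomposition tree are natural numbers; this is no
  restriction, as every finite tree is isomorphic to such a tree. The width carries no \<open>-1\<close>.
\<close>

definition treewidth :: "'a pair_pre_digraph \<Rightarrow> nat" where
  "treewidth G = (LEAST k. \<exists>(T :: nat pair_pre_digraph) \<beta>. tree_decomposition G T \<beta> \<and>
     k = Max ((\<lambda>x. card (\<beta> x)) ` pverts T))"

definition alpha_treewidth :: "'a pair_pre_digraph \<Rightarrow> nat" where
  "alpha_treewidth G = (LEAST k. \<exists>(T :: nat pair_pre_digraph) \<beta>. tree_decomposition G T \<beta> \<and>
     k = Max ((\<lambda>x. independence_number (pair_induce G (\<beta> x))) ` pverts T))"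

text \<open>
  For \<open>c \<ge> 0\<close> the whole vertex set is a modulator and the infimum is a finite, attained
  minimum; for \<open>c < 0\<close> there is no modulator and the value is \<open>\<infinity>\<close>.
\<close>

definition tw_modulator_number :: "int \<Rightarrow> 'a pair_pre_digraph \<Rightarrow> enat" where
  "tw_modulator_number c G =
     (INF S \<in> {S. S \<subseteq> pverts G \<and> int (treewidth (pair_induce G (pverts G - S))) \<le> c}. enat (card S))"

definition graph_class :: "'a pair_pre_digraph set \<Rightarrow> bool" where
  "graph_class \<G> \<longleftrightarrow> (\<forall>G\<in>\<G>. pair_graph G) \<and>
     (\<forall>G\<in>\<G>. \<forall>H. digraph_iso (with_proj G) (with_proj H) \<longrightarrow> H \<in> \<G>)"

definition clique_bounded ::
    "('a pair_pre_digraph \<Rightarrow> enat) \<Rightarrow> 'a pair_pre_digraph set \<Rightarrow> bool" where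
  "clique_bounded \<rho> \<G> \<longleftrightarrow> (\<exists>f :: nat \<Rightarrow> nat. mono f \<and>
     (\<forall>G\<in>\<G>. \<forall>H. induced_subgraph (with_proj H) (with_proj G) \<longrightarrow>
        \<rho> H \<le> enat (f (clique_number H))))"

definition bounded_alpha_treewidth :: "'a pair_pre_digraph set \<Rightarrow> bool" where
  "bounded_alpha_treewidth \<G> \<longleftrightarrow> (\<exists>k :: int.
     \<forall>G\<in>\<G>. \<forall>H. induced_subgraph (with_proj H) (with_proj G) \<longrightarrow>
        int (alpha_treewidth H) \<le> k)"

end

theory Submission
  imports Defs
begin

text \<open>
  Let \<open>S\<close> be a minimum modulator of \<open>H\<close> and \<open>A \<subseteq> S\<close> independent. Replacing \<open>A\<close> in \<open>S\<close> by a minimum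
  modulator of \<open>H[A \<union> (V - S)]\<close> gives another modulator of \<open>H\<close>, so \<open>|A|\<close> is at most the modulator
  number of that graph. A clique of it has at most one vertex in \<open>A\<close> and at most \<open>c\<close> in \<open>V - S\<close>
  (by the Helly property of subtrees), so \<open>|A| \<le> f (c + 1)\<close> for the
  function \<open>f\<close> bounding the modulator number by the clique number. Adding \<open>S\<close> to all bags of a width \<open>c\<close>
  tree decomposition of \<open>H - S\<close> therefore yields bags of independence number at most
  \<open>f (c + 1) + c\<close>.
\<close>

section \<open>The Helly property of subtrees\<close>

text \<open>Cycles as vertex lists over a bare relation: the Helly induction can then shrink the
  vertex set while \<open>E\<close> stays fixed. Length 3 excludes going back and forth along one
  edge.\<close>

definition vcycle :: "'t rel \<Rightarrow> 't list \<Rightarrow> bool" where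
  "vcycle E p \<longleftrightarrow> distinct p \<and> 3 \<le> length p \<and> set (vwalk_arcs (p @ [hd p])) \<subseteq> E"

text \<open>A longest path ends in such an \<open>x\<close>: a neighbour off the path would extend
  it, and one beyond the second vertex would close a cycle. The case \<open>z = x\<close> allows for
  loops in \<open>E\<close>.\<close>

lemma ex_vertex_degree_le_1:
  assumes fin: "finite V" and "V \<noteq> {}" and sym: "sym E"
    and acyc: "\<And>p. set p \<subseteq> V \<Longrightarrow> \<not> vcycle E p"
  obtains x y where "x \<in> V" and "\<And>z. z \<in> V \<Longrightarrow> (x, z) \<in> E \<Longrightarrow> z = x \<or> z = y"
proof -
  define paths where
    "paths = {p. p \<noteq> [] \<and> distinct p \<and> set p \<subseteq> V \<and> set (vwalk_arcs p) \<subseteq> E}"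
  obtain v where "v \<in> V" using \<open>V \<noteq> {}\<close> by blast
  then have "[v] \<in> paths" by (simp add: paths_def)
  moreover have "length p < Suc (card V)" if "p \<in> paths" for p
    using that fin card_mono[of V "set p"] distinct_card[of p] by (simp add: paths_def)
  ultimately obtain p where p: "p \<in> paths" and max: "\<And>q. q \<in> paths \<Longrightarrow> length q \<le> length p"
    using ex_has_greatest_nat[of "\<lambda>p. p \<in> paths" "[v]" length "Suc (card V)"] by auto
  then obtain x xs where xs: "p = x # xs" unfolding paths_def by (cases p) auto
  \<comment> \<open>If \<open>xs = []\<close>, then \<open>hd xs\<close> is an arbitrary value;
    maximality then rules out every neighbour other than \<open>x\<close>.\<close>
  have "z = x \<or> z = hd xs" if z: "z \<in> V" "(x, z) \<in> E" for z
  proof (rule ccontr)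
    assume ne: "\<not> (z = x \<or> z = hd xs)"
    have zx: "(z, x) \<in> E" using z(2) sym by (simp add: symD)
    show False
    proof (cases "z \<in> set xs")
      case False
      then have "z # p \<in> paths" using p xs ne z zx by (auto simp: paths_def)
      then show False using max by force
    next
      case True
      then obtain ys zs where split: "xs = ys @ z # zs" by (meson split_list)
      with ne have "ys \<noteq> []" by auto
      \<comment> \<open>The initial segment of the path up to \<open>z\<close>, closed by the edge
        from \<open>z\<close> to \<open>x\<close>. It has at least three vertices because
        \<open>z\<close> is not the second one.\<close>
      let ?q = "x # ys @ [z]"
      have pq: "p = ?q @ zs" using xs split by simp
      have "set (vwalk_arcs ?q) \<subseteq> E"
        using set_vwalk_arcs_append1[of ?q zs] p pq by (auto simp: paths_def)
      then have "set (vwalk_arcs (?q @ [hd ?q])) \<subseteq> E"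
        using zx by (subst set_vwalk_arcs_snoc) auto
      moreover have "distinct ?q" "set ?q \<subseteq> V" using p pq by (auto simp: paths_def)
      moreover have "3 \<le> length ?q" using \<open>ys \<noteq> []\<close> by (cases ys) auto
      ultimately show False using acyc[of ?q] unfolding vcycle_def by blast
    qed
  qed
  moreover have "x \<in> V" using p xs by (auto simp: paths_def)
  ultimately show thesis using that by blast
qed

text \<open>A walk can enter and leave \<open>x\<close> only through \<open>y\<close>, so each visit
  to \<open>x\<close> can be cut out. A walk ending in \<open>x\<close> is stopped at
  \<open>y\<close> instead; the \<open>if\<close> records this and keeps the induction
  going.\<close>

lemma rtrancl_on_avoid_leaf:
  assumes leaf: "\<And>z. z \<in> X \<Longrightarrow> (x, z) \<in> E \<Longrightarrow> z = x \<or> z = y" and sym: "sym E"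
    and uw: "(u, w) \<in> rtrancl_on X E" and "u \<noteq> x"
  shows "(u, if w = x then y else w) \<in> rtrancl_on (X - {x}) E"
  using uw
proof (induction rule: rtrancl_on_induct)
  case base
  then show ?case using \<open>u \<noteq> x\<close> by auto
next
  case (step w w')
  show ?case
  proof (cases "w = x \<or> w' = x")
    case True
    then have "(x, w) \<in> E \<or> (x, w') \<in> E" "w = x \<longrightarrow> (x, w') \<in> E" "w' = x \<longrightarrow> (x, w) \<in> E"
      using step sym by (auto dest: symD)
    then show ?thesis using leaf step True by (smt (verit, best))
  next
    case False
    then show ?thesis using step by (auto intro: rtrancl_on_into_rtrancl_on)
  qed
qed

text \<open>Induction on \<open>card V\<close>, deleting a leaf \<open>x\<close> with neighbour
  \<open>y\<close>. If \<open>{x}\<close> is a member, every member contains \<open>x\<close>.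
  Otherwise every member through \<open>x\<close> also contains \<open>y\<close>, so deleting
  \<open>x\<close> from all members keeps them connected and pairwise intersecting.\<close>

lemma helly_subtrees:
  assumes "finite V" and sym: "sym E"
    and "\<And>p. set p \<subseteq> V \<Longrightarrow> \<not> vcycle E p"
    and "F \<noteq> {}" and "\<And>X. X \<in> F \<Longrightarrow> X \<subseteq> V"
    and "\<And>X Y. X \<in> F \<Longrightarrow> Y \<in> F \<Longrightarrow> X \<inter> Y \<noteq> {}"
    and "\<And>X u v. X \<in> F \<Longrightarrow> u \<in> X \<Longrightarrow> v \<in> X \<Longrightarrow> (u, v) \<in> rtrancl_on X E"
  shows "\<Inter>F \<noteq> {}"
  using assms(1,3-)
proof (induction "card V" arbitrary: V F rule: less_induct)
  case less
  have "V \<noteq> {}" using less.prems(3-5) by (metis bot.extremum_uniqueI ex_in_conv inf.idem)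
  then obtain x y where x: "x \<in> V"
    and leaf: "\<And>z. z \<in> V \<Longrightarrow> (x, z) \<in> E \<Longrightarrow> z = x \<or> z = y"
    using ex_vertex_degree_le_1[OF less.prems(1) _ sym less.prems(2)] by metis
  show ?case
  proof (cases "{x} \<in> F")
    case True
    then have "x \<in> X" if "X \<in> F" for X using less.prems(5)[OF True that] by auto
    then show ?thesis by blast
  next
    case False
    have avoid: "(u, if w = x then y else w) \<in> rtrancl_on (X - {x}) E"
      if "X \<in> F" "u \<in> X" "u \<noteq> x" "w \<in> X" for X u w
      using that leaf less.prems(4,6) sym
      by (intro rtrancl_on_avoid_leaf) blast+
    \<comment> \<open>Such an \<open>X\<close> has a second vertex \<open>u\<close>, and the walk in
      \<open>X\<close> from \<open>u\<close> towards \<open>x\<close>, stopped before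
      \<open>x\<close>, ends at \<open>y\<close>.\<close>
    have y: "y \<in> X - {x}" if X: "X \<in> F" "x \<in> X" for X
    proof -
      have "X \<noteq> {x}" using X False by metis
      then obtain u where "u \<in> X" "u \<noteq> x" using X by blast
      then show ?thesis using avoid[OF X(1) _ _ X(2)] by (auto dest: in_rtrancl_on_in_F)
    qed
    have "\<Inter>((\<lambda>X. X - {x}) ` F) \<noteq> {}"
    proof (rule less.hyps[of "V - {x}"])
      show "card (V - {x}) < card V" using x less.prems(1) by (meson card_Diff1_less)
      show "\<not> vcycle E p" if "set p \<subseteq> V - {x}" for p using that less.prems(2) by blast
      show "X \<inter> Y \<noteq> {}"
        if *: "X \<in> (\<lambda>X. X - {x}) ` F" "Y \<in> (\<lambda>X. X - {x}) ` F" for X Y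
      proof -
        obtain X' Y' where XY: "X' \<in> F" "Y' \<in> F" "X = X' - {x}" "Y = Y' - {x}"
          using * by blast
        obtain z where "z \<in> X' \<inter> Y'" using less.prems(5) XY by blast
        \<comment> \<open>If the common vertex is the deleted \<open>x\<close>, then
          \<open>y\<close> replaces it.\<close>
        then show ?thesis using y[of X'] y[of Y'] XY by (cases "z = x") auto
      qed
      show "(u, v) \<in> rtrancl_on X E"
        if "X \<in> (\<lambda>X. X - {x}) ` F" "u \<in> X" "v \<in> X" for X u v
        using that avoid by fastforce
    qed (use less.prems in auto)
    then show ?thesis by blast
  qed
qed

section \<open>Cycles and connectivity of trees in relational form\<close>

lemma pcas_vwalk_arcs: "p \<noteq> [] \<Longrightarrow> pcas (hd p) (vwalk_arcs p) (last p)"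
  by (induction p rule: vwalk_arcs.induct) auto

lemma pawalk_verts_vwalk_arcs: "p \<noteq> [] \<Longrightarrow> pawalk_verts (hd p) (vwalk_arcs p) = p"
  by (induction p rule: vwalk_arcs.induct) auto

lemma vcycle_imp_cycle:
  assumes p: "vcycle (parcs T) p" and "set p \<subseteq> pverts T"
  shows "pre_digraph.cycle (with_proj T) (vwalk_arcs (p @ [hd p]))"
    and "3 \<le> length (vwalk_arcs (p @ [hd p]))"
proof -
  interpret pair_pre_digraph T .
  let ?w = "vwalk_arcs (p @ [hd p])"
  have ne: "p \<noteq> []" using p by (auto simp: vcycle_def)
  have "awalk (hd p) ?w (hd p)"
    unfolding awalk_def using pcas_vwalk_arcs[of "p @ [hd p]"] ne assms by (auto simp: vcycle_def)
  moreover have "distinct (tl (pawalk_verts (hd p) ?w))"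
    using pawalk_verts_vwalk_arcs[of "p @ [hd p]"] ne p by (cases p) (auto simp: vcycle_def)
  moreover show "3 \<le> length ?w"
    using p vwalk_length_simp[of "p @ [hd p]"] unfolding vcycle_def vwalk_length_def by simp
  ultimately show "cycle ?w" unfolding cycle_def by auto
qed

text \<open>\<open>connected\<close> speaks of the symmetric closure, which adds no arcs here
  because the arcs of \<open>T\<close> are already symmetric.\<close>

lemma connected_induceD:
  assumes "pair_graph T" and "Digraph_Component.connected (with_proj T \<restriction> X)"
    and "u \<in> X" "v \<in> X"
  shows "(u, v) \<in> rtrancl_on X (parcs T)"
proof -
  have "sym (parcs T)"
    using assms(1) by (auto simp: pair_graph_def pair_pseudo_graph_def pair_sym_digraph_def
        pair_sym_digraph_axioms_def symmetric_def)
  then have "parcs (mk_symmetric (with_proj T \<restriction> X)) \<subseteq> parcs T"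
    by (auto simp: mk_symmetric_def dest: symD)
  moreover have "(u, v) \<in> rtrancl_on X (parcs (mk_symmetric (with_proj T \<restriction> X)))"
    using assms(2-) by (simp add: Digraph_Component.connected_def strongly_connected_def reachable_def)
  ultimately show ?thesis by (rule rtrancl_on_mono[OF _ order_refl])
qed

section \<open>Induced subgraphs\<close>

lemma pair_graph_iff:
  "pair_graph G \<longleftrightarrow> finite (pverts G) \<and> parcs G \<subseteq> pverts G \<times> pverts G \<and> sym (parcs G) \<and> irrefl (parcs G)"
proof
  assume "pair_graph G"
  then interpret pair_graph G .
  show "finite (pverts G) \<and> parcs G \<subseteq> pverts G \<times> pverts G \<and> sym (parcs G) \<and> irrefl (parcs G)"
    using pair_sym_arcs pair_no_loops pair_finite_verts
    by (fastforce simp: symmetric_def irrefl_def dest: in_arcsD1 in_arcsD2)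
next
  assume *: "finite (pverts G) \<and> parcs G \<subseteq> pverts G \<times> pverts G \<and> sym (parcs G) \<and> irrefl (parcs G)"
  then have "finite (parcs G)" by (meson finite_SigmaI finite_subset)
  with * show "pair_graph G"
    by unfold_locales (auto simp: symmetric_def irrefl_def)
qed

lemma pair_induce_simps [simp]:
  "pverts (pair_induce G S) = S"
  "parcs (pair_induce G S) = {e \<in> parcs G. fst e \<in> S \<and> snd e \<in> S}"
  by (simp_all add: pair_induce_def)

lemma pair_graph_induce:
  assumes "pair_graph G" and "S \<subseteq> pverts G"
  shows "pair_graph (pair_induce G S)"
  using assms by (auto simp: pair_graph_iff sym_def irrefl_def intro: finite_subset)

lemma pair_induce_induce: "R \<subseteq> S \<Longrightarrow> pair_induce (pair_induce G S) R = pair_induce G R"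
  by (auto simp: pair_induce_def)

text \<open>Turns quantification over induced subgraphs into quantification over vertex
  sets.\<close>

lemma induced_subgraph_iff_pair_induce:
  assumes "pair_graph G"
  shows "induced_subgraph (with_proj H) (with_proj G) \<longleftrightarrow>
    (\<exists>S\<subseteq>pverts G. H = pair_induce G S)"
proof
  assume "induced_subgraph (with_proj H) (with_proj G)"
  then show "\<exists>S\<subseteq>pverts G. H = pair_induce G S"
    by (intro exI[of _ "pverts H"])
      (auto simp: induced_subgraph_def subgraph_def intro!: pair_pre_digraph.equality)
next
  interpret pair_graph G by fact
  assume "\<exists>S\<subseteq>pverts G. H = pair_induce G S"
  then show "induced_subgraph (with_proj H) (with_proj G)"
    using induced_induce by (auto simp: with_proj_pair_induce)
qed

text \<open>\<open>P {}\<close> and the finite \<open>V\<close> ensure that \<open>Max\<close> is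
  taken over a nonempty finite set, where its value is meaningful.\<close>

lemma Max_card_le:
  fixes P :: "'a set \<Rightarrow> bool"
  assumes "finite V" and "\<And>S. P S \<Longrightarrow> S \<subseteq> V" and "P {}" and "\<And>S. P S \<Longrightarrow> card S \<le> k"
  shows "Max (card ` {S. P S}) \<le> k"
proof -
  have "finite {S. P S}" using assms by (intro finite_subset[of "{S. P S}" "Pow V"]) auto
  then show ?thesis using assms by (subst Max_le_iff) auto
qed

lemma independence_number_le:
  assumes "finite (pverts G)" and "\<And>S. independent_in G S \<Longrightarrow> card S \<le> k"
  shows "independence_number G \<le> k"
  unfolding independence_number_def
  using assms by (intro Max_card_le) (auto simp: independent_in_def)

lemma clique_number_le:
  assumes "finite (pverts G)" and "\<And>S. clique_in G S \<Longrightarrow> card S \<le> k"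
  shows "clique_number G \<le> k"
  unfolding clique_number_def
  using assms by (intro Max_card_le) (auto simp: clique_in_def)

section \<open>Tree decompositions\<close>

text \<open>Provides the existence needed for the \<open>LEAST\<close> in \<open>treewidth\<close>
  to be attained.\<close>

lemma tree_decomposition_single_bag:
  assumes "pair_graph G"
  shows "tree_decomposition G \<lparr>pverts = {t}, parcs = {}\<rparr> (\<lambda>_. pverts G)"
proof -
  let ?T = "\<lparr>pverts = {t}, parcs = {}\<rparr>"
  interpret T: pair_pre_digraph ?T .
  have conn: "Digraph_Component.connected (with_proj ?T)"
    by (auto simp: Digraph_Component.connected_def strongly_connected_def reachable_def mk_symmetric_def)
  have "pair_graph ?T" by (simp add: pair_graph_iff sym_def irrefl_def)
  moreover have "\<not> T.cycle p" for p by (auto simp: T.cycle_def T.awalk_def)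
  moreover have "Digraph_Component.connected (with_proj ?T \<restriction> {t})"
    using conn by (simp add: induce_subgraph_def with_proj_def)
  ultimately show ?thesis
    using conn assms by (auto simp: tree_decomposition_def undirected_tree_def pair_graph_iff)
qed

lemma treewidth_attained:
  assumes "pair_graph G"
  obtains T :: "nat pair_pre_digraph" and \<beta>
  where "tree_decomposition G T \<beta>" and "\<And>x. x \<in> pverts T \<Longrightarrow> card (\<beta> x) \<le> treewidth G"
proof -
  let ?P = "\<lambda>k. \<exists>(T :: nat pair_pre_digraph) \<beta>. tree_decomposition G T \<beta> \<and>
     k = Max ((\<lambda>x. card (\<beta> x)) ` pverts T)"
  have "\<exists>k. ?P k"
    by (intro exI conjI) (rule tree_decomposition_single_bag[OF assms], rule refl)
  then have "?P (treewidth G)" unfolding treewidth_def by (rule LeastI_ex)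
  then obtain T :: "nat pair_pre_digraph" and \<beta> where td: "tree_decomposition G T \<beta>"
    and w: "treewidth G = Max ((\<lambda>x. card (\<beta> x)) ` pverts T)" by blast
  have "finite (pverts T)"
    using td by (auto simp: tree_decomposition_def undirected_tree_def pair_graph_iff)
  with td w that show thesis by simp
qed

lemma undirected_tree_nonempty: "undirected_tree T \<Longrightarrow> pverts T \<noteq> {}"
  by (auto simp: undirected_tree_def Digraph_Component.connected_def strongly_connected_def)

lemma alpha_treewidth_le:
  fixes T :: "nat pair_pre_digraph"
  assumes td: "tree_decomposition G T \<beta>"
    and "\<And>x. x \<in> pverts T \<Longrightarrow> independence_number (pair_induce G (\<beta> x)) \<le> k"
  shows "alpha_treewidth G \<le> k"
proof -
  have "alpha_treewidth G \<le> Max ((\<lambda>x. independence_number (pair_induce G (\<beta> x))) ` pverts T)"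
    unfolding alpha_treewidth_def using td by (intro Least_le) blast
  also have "\<dots> \<le> k"
  proof -
    have "undirected_tree T" using td by (simp add: tree_decomposition_def)
    then have "finite (pverts T)" "pverts T \<noteq> {}"
      using undirected_tree_nonempty by (auto simp: undirected_tree_def pair_graph_iff)
    then show ?thesis using assms(2) by (subst Max_le_iff) auto
  qed
  finally show ?thesis .
qed

text \<open>The node sets of the vertices of \<open>K\<close> are subtrees, and they meet pairwise
  because both ends of an edge share a bag. A node common to all of them exists by the Helly
  property.\<close>

lemma clique_subset_bag:
  assumes td: "tree_decomposition G T \<beta>" and K: "clique_in G K"
  obtains x where "x \<in> pverts T" and "K \<subseteq> \<beta> x"
proof (cases "K = {}")
  \<comment> \<open>Treated separately since the Helly property requires a nonempty family; any node
    will do.\<close>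
  case True
  have "pverts T \<noteq> {}" using td undirected_tree_nonempty by (auto simp: tree_decomposition_def)
  then show thesis using that True by blast
next
  case False
  have T: "pair_graph T" using td by (simp add: tree_decomposition_def undirected_tree_def)
  define nodes where "nodes v = {x \<in> pverts T. v \<in> \<beta> x}" for v
  have "\<Inter>(nodes ` K) \<noteq> {}"
  proof (rule helly_subtrees[where V = "pverts T" and E = "parcs T"])
    show "finite (pverts T)" "sym (parcs T)" using T by (auto simp: pair_graph_iff)
    show "\<not> vcycle (parcs T) p" if "set p \<subseteq> pverts T" for p
      using vcycle_imp_cycle[OF _ that] td by (auto simp: tree_decomposition_def undirected_tree_def)
    show "X \<inter> Y \<noteq> {}" if XY: "X \<in> nodes ` K" "Y \<in> nodes ` K" for X Y
    proof -
      obtain u v where uv: "u \<in> K" "v \<in> K" "X = nodes u" "Y = nodes v" using XY by blast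
      then have "u \<in> pverts G" and "u = v \<or> (u, v) \<in> parcs G" using K by (auto simp: clique_in_def)
      then show ?thesis using td uv unfolding tree_decomposition_def nodes_def by blast
    qed
    show "(x, y) \<in> rtrancl_on X (parcs T)" if "X \<in> nodes ` K" "x \<in> X" "y \<in> X" for X x y
    proof (rule connected_induceD[OF T])
      show "Digraph_Component.connected (with_proj T \<restriction> X)"
        using that(1) td K by (auto simp: tree_decomposition_def nodes_def clique_in_def)
    qed fact+
  qed (use False in \<open>auto simp: nodes_def\<close>)
  then show thesis using that False by (auto simp: nodes_def)
qed

text \<open>The clique fits into one bag; no \<open>+ 1\<close> appears because the width is the
  plain bag size.\<close>

lemma card_clique_le_treewidth:
  assumes "pair_graph G" and "clique_in G K"
  shows "card K \<le> treewidth G"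
proof -
  obtain T :: "nat pair_pre_digraph" and \<beta> where td: "tree_decomposition G T \<beta>"
    and w: "\<And>x. x \<in> pverts T \<Longrightarrow> card (\<beta> x) \<le> treewidth G"
    using treewidth_attained[OF assms(1)] by blast
  obtain x where x: "x \<in> pverts T" "K \<subseteq> \<beta> x" using clique_subset_bag[OF td assms(2)] .
  have "finite (\<beta> x)"
    using td x assms(1) by (auto simp: tree_decomposition_def pair_graph_iff intro: finite_subset)
  then show ?thesis using card_mono x w by (meson le_trans)
qed

text \<open>A vertex of \<open>S\<close> now occupies all of \<open>T\<close>, which is connected,
  and the other vertices keep their nodes. An edge with an end in \<open>S\<close> is covered by any
  bag containing its other end.\<close>

lemma tree_decomposition_add_to_bags:
  assumes G: "pair_graph G" and S: "S \<subseteq> pverts G"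
    and td: "tree_decomposition (pair_induce G (pverts G - S)) T \<beta>"
  shows "tree_decomposition G T (\<lambda>x. \<beta> x \<union> S)"
proof -
  have T: "undirected_tree T" using td by (simp add: tree_decomposition_def)
  have bags: "\<beta> x \<subseteq> pverts G - S" if "x \<in> pverts T" for x
    using td that by (auto simp: tree_decomposition_def)
  have cover: "\<exists>x\<in>pverts T. v \<in> \<beta> x \<union> S" if "v \<in> pverts G" for v
    using td that undirected_tree_nonempty[OF T] by (cases "v \<in> S") (auto simp: tree_decomposition_def)
  have "\<exists>x\<in>pverts T. u \<in> \<beta> x \<union> S \<and> v \<in> \<beta> x \<union> S" if uv: "(u, v) \<in> parcs G" for u v
  proof -
    have "u \<in> pverts G" "v \<in> pverts G" using uv G by (auto simp: pair_graph_iff)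
    then show ?thesis
      using td uv cover undirected_tree_nonempty[OF T]
      by (cases "u \<in> S"; cases "v \<in> S") (auto simp: tree_decomposition_def)
  qed
  moreover have "Digraph_Component.connected (with_proj T \<restriction> {x \<in> pverts T. v \<in> \<beta> x \<union> S})"
    if v: "v \<in> pverts G" for v
  proof (cases "v \<in> S")
    case True
    have "parcs T \<subseteq> pverts T \<times> pverts T"
      using T by (auto simp: undirected_tree_def pair_graph_iff)
    then have "with_proj T \<restriction> pverts T = with_proj T"
      by (auto simp: induce_subgraph_def with_proj_def)
    then show ?thesis using T True by (simp add: undirected_tree_def)
  next
    case False
    then show ?thesis using td v by (simp add: tree_decomposition_def)
  qed
  ultimately show ?thesis
    using T S bags cover unfolding tree_decomposition_def by blast
qed

section \<open>Modulators\<close>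

definition tw_modulator :: "int \<Rightarrow> 'a pair_pre_digraph \<Rightarrow> 'a set \<Rightarrow> bool" where
  "tw_modulator c G S \<longleftrightarrow> S \<subseteq> pverts G \<and> int (treewidth (pair_induce G (pverts G - S))) \<le> c"

text \<open>Relaxing the bound to \<open>< Suc k\<close> lets a member be read off the infimum
  without proving that it is attained.\<close>

lemma tw_modulator_number_leD:
  assumes "tw_modulator_number c G \<le> enat k"
  obtains S where "tw_modulator c G S" and "card S \<le> k"
proof -
  have "tw_modulator_number c G < enat (Suc k)"
    using assms by (meson enat_ord_simps(2) le_less_trans lessI)
  then show thesis
    using that unfolding tw_modulator_number_def INF_less_iff tw_modulator_def by auto
qed

text \<open>An exchange argument; \<open>bound\<close> is applied to a set \<open>R\<close> that
  depends on \<open>A\<close>.\<close>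

lemma card_independent_in_minimum_modulator:
  assumes G: "pair_graph G" and S: "tw_modulator c G S"
    and min: "\<And>R. tw_modulator c G R \<Longrightarrow> card S \<le> card R"
    and A: "A \<subseteq> S" "independent_in G A"
    and bound: "\<And>R. R \<subseteq> pverts G \<Longrightarrow>
      tw_modulator_number c (pair_induce G R) \<le> enat (f (clique_number (pair_induce G R)))"
    and "mono f"
  shows "card A \<le> f (Suc (nat c))"
proof -
  let ?V = "pverts G"
  let ?R = "A \<union> (?V - S)"
  have R: "?R \<subseteq> ?V" and SV: "S \<subseteq> ?V" using S A by (auto simp: tw_modulator_def)
  have fin: "finite ?V" using G by (simp add: pair_graph_iff)
  have finS: "finite S" using fin SV by (rule rev_finite_subset)
  \<comment> \<open>One vertex comes from the independent set \<open>A\<close>, and at most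
    \<open>c\<close> from outside \<open>S\<close>, where the treewidth is at most
    \<open>c\<close>.\<close>
  have "clique_number (pair_induce G ?R) \<le> Suc (nat c)"
  proof (rule clique_number_le)
    show "finite (pverts (pair_induce G ?R))" using R fin by (auto intro: finite_subset)
    fix K assume K: "clique_in (pair_induce G ?R) K"
    have finK: "finite K" using K R fin by (auto simp: clique_in_def intro: finite_subset)
    have "card (K \<inter> A) \<le> Suc 0"
    proof -
      have "u = v" if "u \<in> K \<inter> A" "v \<in> K \<inter> A" for u v
        using that K A by (force simp: clique_in_def independent_in_def)
      then show ?thesis using finK by (subst card_le_Suc0_iff_eq) auto
    qed
    moreover have "clique_in (pair_induce G (?V - S)) (K - A)"
      using K A by (auto simp: clique_in_def)
    then have "card (K - A) \<le> treewidth (pair_induce G (?V - S))"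
      using G by (intro card_clique_le_treewidth pair_graph_induce) auto
    moreover have "card K = card (K \<inter> A) + card (K - A)"
      using finK by (metis card_Int_Diff)
    ultimately show "card K \<le> Suc (nat c)" using S unfolding tw_modulator_def by linarith
  qed
  then have "tw_modulator_number c (pair_induce G ?R) \<le> enat (f (Suc (nat c)))"
    using bound[OF R] \<open>mono f\<close> by (meson enat_ord_simps(1) monoD order_trans)
  then obtain Z where Z: "tw_modulator c (pair_induce G ?R) Z" "card Z \<le> f (Suc (nat c))"
    by (rule tw_modulator_number_leD)
  have ZR: "Z \<subseteq> ?R" using Z by (simp add: tw_modulator_def)
  \<comment> \<open>After the exchange the same graph remains as after removing \<open>Z\<close>
    from the graph on \<open>?R\<close>, so its treewidth is at most \<open>c\<close>.\<close>
  have eq: "?V - ((S - A) \<union> Z) = ?R - Z" using A SV ZR by auto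
  have "tw_modulator c G ((S - A) \<union> Z)"
    using Z SV R unfolding tw_modulator_def eq by (auto simp: pair_induce_induce)
  then have "card S \<le> card ((S - A) \<union> Z)" by (rule min)
  also have "\<dots> \<le> card (S - A) + card Z" by (rule card_Un_le)
  also have "card (S - A) = card S - card A"
    using A finS by (meson card_Diff_subset finite_subset)
  \<comment> \<open>Since \<open>A\<close> is contained in \<open>S\<close>, the natural number
    subtraction is not truncated, and \<open>card A \<le> card Z\<close> follows.\<close>
  finally show ?thesis using Z(2) card_mono[OF finS A(1)] by linarith
qed

text \<open>An independent set in an enlarged bag splits into a part in \<open>S\<close>, bounded by
  the exchange argument, and a part in the old bag, bounded by the bag size.\<close>

lemma alpha_treewidth_le_if_modulator_bound:
  assumes G: "pair_graph G" and "mono f"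
    and bound: "\<And>R. R \<subseteq> pverts G \<Longrightarrow>
      tw_modulator_number c (pair_induce G R) \<le> enat (f (clique_number (pair_induce G R)))"
  shows "alpha_treewidth G \<le> f (Suc (nat c)) + nat c"
proof -
  let ?V = "pverts G"
  have fin: "finite ?V" using G by (simp add: pair_graph_iff)
  \<comment> \<open>The finite bound for \<open>G\<close> itself yields a modulator. For negative
    \<open>c\<close> there is none, so \<open>bound\<close> is contradictory.\<close>
  have "\<exists>S. tw_modulator c G S"
  proof -
    have "pair_induce G ?V = G" using G by (auto simp: pair_graph_iff intro!: pair_pre_digraph.equality)
    then show ?thesis using bound[of ?V] tw_modulator_number_leD by (metis order_refl)
  qed
  then obtain S where S: "tw_modulator c G S"
    and min: "\<And>R. tw_modulator c G R \<Longrightarrow> card S \<le> card R"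
    using ex_has_least_nat[of "tw_modulator c G" _ card] by blast
  have SV: "S \<subseteq> ?V" using S by (simp add: tw_modulator_def)
  let ?G = "pair_induce G (?V - S)"
  have "pair_graph ?G" using G by (rule pair_graph_induce) auto
  then obtain T :: "nat pair_pre_digraph" and \<beta> where td: "tree_decomposition ?G T \<beta>"
    and w: "\<And>x. x \<in> pverts T \<Longrightarrow> card (\<beta> x) \<le> treewidth ?G"
    using treewidth_attained by blast
  show ?thesis
  proof (rule alpha_treewidth_le[OF tree_decomposition_add_to_bags[OF G SV td]])
    fix x assume x: "x \<in> pverts T"
    then have bag: "\<beta> x \<subseteq> ?V" using td by (auto simp: tree_decomposition_def)
    have finb: "finite (\<beta> x)" "finite S" using bag SV fin by (auto intro: finite_subset)
    show "independence_number (pair_induce G (\<beta> x \<union> S)) \<le> f (Suc (nat c)) + nat c"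
    proof (rule independence_number_le)
      show "finite (pverts (pair_induce G (\<beta> x \<union> S)))" using finb by simp
      fix I assume I: "independent_in (pair_induce G (\<beta> x \<union> S)) I"
      then have sub: "I \<subseteq> \<beta> x \<union> S" by (simp add: independent_in_def)
      have "independent_in G (I \<inter> S)" using I SV by (auto simp: independent_in_def)
      then have "card (I \<inter> S) \<le> f (Suc (nat c))"
        using card_independent_in_minimum_modulator[OF G S min _ _ bound \<open>mono f\<close>] by blast
      moreover have "card (I - S) \<le> card (\<beta> x)" using sub finb by (intro card_mono) auto
      moreover have "card I = card (I \<inter> S) + card (I - S)"
        using sub finb by (metis card_Int_Diff finite_Un finite_subset)
      ultimately show "card I \<le> f (Suc (nat c)) + nat c"
        using w[OF x] S unfolding tw_modulator_def by linarith
    qed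
  qed
qed

theorem theorem5p23:
  fixes c :: int and \<G> :: "'a pair_pre_digraph set"
  assumes "graph_class \<G>"
    and "clique_bounded (tw_modulator_number c) \<G>"
  shows "bounded_alpha_treewidth \<G>"
proof -
  obtain f where "mono f" and f: "\<And>G H. G \<in> \<G> \<Longrightarrow> induced_subgraph (with_proj H) (with_proj G) \<Longrightarrow>
      tw_modulator_number c H \<le> enat (f (clique_number H))"
    using assms(2) unfolding clique_bounded_def by blast
  have "alpha_treewidth H \<le> f (Suc (nat c)) + nat c"
    if G: "G \<in> \<G>" and H: "induced_subgraph (with_proj H) (with_proj G)" for G H
  proof -
    have pG: "pair_graph G" using assms(1) G by (simp add: graph_class_def)
    obtain S where S: "S \<subseteq> pverts G" "H = pair_induce G S"
      using H induced_subgraph_iff_pair_induce[OF pG] by blast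
    show ?thesis
    proof (rule alpha_treewidth_le_if_modulator_bound[OF _ \<open>mono f\<close>])
      show "pair_graph H" using pair_graph_induce pG S by blast
      fix R assume "R \<subseteq> pverts H"
      \<comment> \<open>Induced subgraphs of \<open>H\<close> are induced in \<open>G\<close>, so
        the bound for \<open>G\<close> is inherited.\<close>
      then have "pair_induce H R = pair_induce G R" "R \<subseteq> pverts G"
        using S by (auto simp: pair_induce_induce)
      then show "tw_modulator_number c (pair_induce H R) \<le> enat (f (clique_number (pair_induce H R)))"
        using f[OF G] induced_subgraph_iff_pair_induce[OF pG] by metis
    qed
  qed
  then show ?thesis unfolding bounded_alpha_treewidth_def by (meson of_nat_mono)
qed

end
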